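(* For all integers $r\ge1$ and all $(\alpha;\beta)\in\mathcal{U}_r^1$ for which no $\beta_i+1$ is a non-positive integer and for which $S_{r+1}(\alpha)+S_r(\beta)\neq0$, $$ {}_{r+1}F_r\left(\begin{array}{c}\alpha_1,\,\ldots,\,\alpha_{r+1}\\ \beta_1+1,\,\ldots,\,\beta_r+1\end{array}\right) =\left[\frac{-S_r(\alpha)+S_r(\beta)}{S_{r+1}(\alpha)+S_r(\beta)}\right] \frac{\Gamma(\beta_1+1)\cdots\Gamma(\beta_r+1)}{\Gamma(\alpha_1+1)\cdots\Gamma(\alpha_{r+1}+1)}. $$
   Context: ${}_{r+1}F_r\left(\begin{array}{c}a_1,\ldots,a_{r+1}\\ b_1,\ldots,b_r\end{array}\right)$ with no argument shown means the hypergeometric series at argument $1$: $\sum_{k\ge0}\frac{(a_1)_k\cdots(a_{r+1})_k}{(b_1)_k\cdots(b_r)_k\,k!}$, where $(a)_k=a(a+1)\cdots(a+k-1)$, $(a)_0=1$. It converges if $\operatorname{Re}\left(\sum_i b_i-\sum_i a_i\right)>0$. For $(\alpha;\beta)=(\alpha_1,\dots,\alpha_{r+1};\beta_1,\dots,\beta_r)\in\mathbb{C}^{r+1}\times\mathbb{C}^r$, $S_l(\alpha)$ and $S_l(\beta)$ denote the $l$-th elementary symmetric polynomials in $\alpha_1,\dots,\alpha_{r+1}$ and in $\beta_1,\dots,\beta_r$ respectively, with $S_0(\alpha)=S_0(\beta)=1$. $\mathcal{U}_r^1\subset\mathbb{C}^{r+1}\times\mathbb{C}^r$ is the common solution set of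 the equations $$[S_{l-1}(\alpha)-S_{l-1}(\beta)]\,[S_{r+1}(\alpha)+S_r(\beta)]+[S_l(\alpha)-S_l(\beta)+S_{l-1}(\beta)]\,[-S_r(\alpha)+S_r(\beta)]=0,\qquad l=1,\dots,r.$$ A gamma quotient with a denominator argument equal to a non-positive integer is interpreted as zero.
   Formalization: Added hypothesis: S_r(α) ≠ S_r(β), or some α_i+1 is a non-positive integer. Without it the claim fails: r=1, α=(1,1), β=(2) gives series value 2 but right-hand side 0; the formula is false at every excluded point. *)

theory Defs
  imports "HOL-Analysis.Analysis"
begin

text \<open>
  Parameter vectors in $C^{r+1}$ and $C^r$ are lists of the corresponding length, since $r$ is
  quantified.
\<close>

definition elem_sym :: "nat \<Rightarrow> 'a::comm_ring_1 list \<Rightarrow> 'a" where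
  "elem_sym l xs = (\<Sum>X | X \<subseteq> {..<length xs} \<and> card X = l. \<Prod>i\<in>X. xs ! i)"

text \<open>
  The last argument of \<^const>\<open>fps_hypergeo\<close> scales the power series variable, so \<open>1\<close> there gives
  the standard series, which is then evaluated at \<open>1\<close>.  The factor \<open>k!\<close> in its denominator is
  implicit, i.e. not listed in the lower parameters.
\<close>

definition hypergeo_1 :: "complex list \<Rightarrow> complex list \<Rightarrow> complex" where
  "hypergeo_1 as bs = eval_fps (fps_hypergeo as bs 1) 1"

definition hypergeo_1_converges :: "complex list \<Rightarrow> complex list \<Rightarrow> bool" where
  "hypergeo_1_converges as bs \<longleftrightarrow> summable (\<lambda>k. fps_nth (fps_hypergeo as bs 1) k)"

definition U1 :: "nat \<Rightarrow> (complex list \<times> complex list) set" where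
  "U1 r = {(\<alpha>, \<beta>). length \<alpha> = r + 1 \<and> length \<beta> = r \<and>
     (\<forall>l\<in>{1..r}.
        (elem_sym (l - 1) \<alpha> - elem_sym (l - 1) \<beta>) * (elem_sym (r + 1) \<alpha> + elem_sym r \<beta>) +
        (elem_sym l \<alpha> - elem_sym l \<beta> + elem_sym (l - 1) \<beta>) * (- elem_sym r \<alpha> + elem_sym r \<beta>)
        = 0)}"

text \<open>
  \<open>Gamma_quotient as bs\<close> has the numerator arguments \<open>as\<close> and the denominator arguments \<open>bs\<close>.
  As \<^const>\<open>Gamma\<close> is \<open>0\<close> at its poles and division by \<open>0\<close> yields \<open>0\<close>, the quotient is \<open>0\<close> as soon as
  some element of \<open>bs\<close> is a non-positive integer.
\<close>

definition Gamma_quotient :: "complex list \<Rightarrow> complex list \<Rightarrow> complex" where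
  "Gamma_quotient as bs = prod_list (map Gamma as) / prod_list (map Gamma bs)"

text \<open>
  On the part of \<^const>\<open>U1\<close> where \<open>elem_sym r \<alpha> = elem_sym r \<beta>\<close> and
  \<open>elem_sym (r + 1) \<alpha> + elem_sym r \<beta> \<noteq> 0\<close>, the coefficient
  \<open>(- elem_sym r \<alpha> + elem_sym r \<beta>) / (elem_sym (r + 1) \<alpha> + elem_sym r \<beta>)\<close> is \<open>0\<close>, whereas the
  series equals the plain quotient \<open>Gamma_quotient (map (\<lambda>b. b + 1) \<beta>) (map (\<lambda>a. a + 1) \<alpha>)\<close>.
  For instance, \<open>([1, 1], [2])\<close> lies in \<open>U1 1\<close> and the series with parameters \<open>[1, 1]\<close> and \<open>[3]\<close>
  has the value \<open>2\<close>.  So a summation formula with that coefficient can hold there only if the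
  quotient vanishes, i.e. if \<open>a + 1\<close> is a non-positive integer for some \<open>a\<close> in \<open>\<alpha>\<close>;
  the other points of that part have to be excluded by hypothesis.
\<close>

end

theory Submission
  imports Defs
begin

text \<open>
  Write \<open>A\<^sub>l\<close> and \<open>B\<^sub>l\<close> for the elementary symmetric functions of \<open>\<alpha>\<close> and \<open>\<beta>\<close>,
  \<open>P(x) = (x + \<alpha>\<^sub>1) \<dots> (x + \<alpha>\<^sub>r\<^sub>+\<^sub>1)\<close>, \<open>Q(x) = (x + \<beta>\<^sub>1) \<dots> (x + \<beta>\<^sub>r)\<close>,
  \<open>c = A\<^sub>r\<^sub>+\<^sub>1 + B\<^sub>r\<close> and \<open>d = B\<^sub>r - A\<^sub>r\<close>.  The equations of \<^const>\<open>U1\<close> say precisely that all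
  coefficients but the constant one vanish in
  \<open>P(x) (d x + c) - x Q(x) (d x + c - d) = c A\<^sub>r\<^sub>+\<^sub>1\<close>.  Evaluated at \<open>x = n\<close>, this identity makes the
  series telescope (Gosper summation): \<open>c\<close> times its \<open>n\<close>-th partial sum is \<open>d n + c\<close> times the
  product of the \<open>(\<alpha>\<^sub>i + 1)\<^sub>n\<close> divided by \<open>n!\<close> and the product of the \<open>(\<beta>\<^sub>i + 1)\<^sub>n\<close>.  If \<open>d \<noteq> 0\<close>, the
  equation with \<open>l = 1\<close> gives \<open>A\<^sub>1 - B\<^sub>1 = -1\<close>, so Euler's limit formula for the Gamma function
  yields the limit; if \<open>d = 0\<close>, the partial sums are eventually \<open>0\<close>.
\<close>

section \<open>Elementary symmetric functions\<close>

lemma prod_list_conv_prod: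
  "prod_list (map f xs) = (\<Prod>i<length xs. f (xs ! i))"
  by (simp add: prod.list_conv_set_nth atLeast0LessThan)

lemma elem_sym_0 [simp]: "elem_sym 0 xs = 1"
proof -
  have "{X. X \<subseteq> {..<length xs} \<and> card X = 0} = {{}}"
    by (auto dest: finite_subset)
  then show ?thesis
    by (simp add: elem_sym_def)
qed

lemma elem_sym_1: "elem_sym 1 xs = sum_list xs"
proof -
  have "{X. X \<subseteq> {..<length xs} \<and> card X = 1} = (\<lambda>i. {i}) ` {..<length xs}"
    by (auto simp: card_1_singleton_iff)
  then show ?thesis
    by (simp add: elem_sym_def sum.reindex sum.list_conv_set_nth atLeast0LessThan)
qed

lemma elem_sym_eq_0: "elem_sym l xs = 0" if "length xs < l"
proof -
  have "{X. X \<subseteq> {..<length xs} \<and> card X = l} = {}"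
    using that by (auto dest!: card_mono[OF finite_lessThan])
  then show ?thesis
    by (simp only: elem_sym_def sum.empty)
qed

text \<open>Vieta's formula: expand the product over all subsets of positions, then group the
  subsets by cardinality.\<close>

lemma prod_list_add_conv_elem_sym:
  "(\<Prod>a\<leftarrow>xs. x + a) = (\<Sum>l\<le>length xs. elem_sym l xs * x ^ (length xs - l))"
proof -
  let ?I = "{..<length xs}"
  have "(\<Prod>a\<leftarrow>xs. x + a) = (\<Prod>i\<in>?I. xs ! i + x)"
    by (simp add: prod_list_conv_prod add.commute)
  also have "\<dots> = (\<Sum>X\<in>Pow ?I. (\<Prod>i\<in>X. xs ! i) * x ^ card (?I - X))"
    by (simp add: prod_add)
  also have "\<dots> = (\<Sum>X\<in>Pow ?I. (\<Prod>i\<in>X. xs ! i) * x ^ (length xs - card X))"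
    by (intro sum.cong) (auto simp: card_Diff_subset finite_subset)
  also have "\<dots> = (\<Sum>l\<le>length xs. \<Sum>X | X \<in> Pow ?I \<and> card X = l.
      (\<Prod>i\<in>X. xs ! i) * x ^ (length xs - card X))"
    using card_mono[of ?I]
    by (intro sum.group[symmetric]) auto
  also have "\<dots> = (\<Sum>l\<le>length xs. elem_sym l xs * x ^ (length xs - l))"
    by (intro sum.cong) (auto simp: elem_sym_def sum_distrib_right intro!: sum.cong)
  finally show ?thesis .
qed

text \<open>Put \<open>x = 0\<close> in Vieta's formula: as \<open>0 ^ 0 = 1\<close>, only the last
  summand survives.\<close>

lemma elem_sym_length: "elem_sym (length xs) xs = prod_list xs"
proof -
  have "(\<Prod>a\<leftarrow>xs. 0 + a) = (\<Sum>l\<le>length xs. if l = length xs then elem_sym l xs else 0)"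
    unfolding prod_list_add_conv_elem_sym by (intro sum.cong) (auto simp: power_0_left)
  then show ?thesis
    by simp
qed

lemma U1_polynomial_identity:
  fixes x :: complex
  assumes U: "(\<alpha>, \<beta>) \<in> U1 r"
  defines "c \<equiv> elem_sym (r + 1) \<alpha> + elem_sym r \<beta>"
    and "d \<equiv> - elem_sym r \<alpha> + elem_sym r \<beta>"
  shows "(\<Prod>a\<leftarrow>\<alpha>. x + a) * (d * x + c) - x * (\<Prod>b\<leftarrow>\<beta>. x + b) * (d * x + c - d) =
    c * elem_sym (r + 1) \<alpha>"
proof -
  let ?A = "\<lambda>l. elem_sym l \<alpha>" and ?B = "\<lambda>l. elem_sym l \<beta>"
  let ?P = "\<Prod>a\<leftarrow>\<alpha>. x + a" and ?Q = "\<Prod>b\<leftarrow>\<beta>. x + b"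
  from U have len: "length \<alpha> = r + 1" "length \<beta> = r"
    and eq: "\<And>l. l \<in> {1..r} \<Longrightarrow>
      (?A (l - 1) - ?B (l - 1)) * c + (?A l - ?B l + ?B (l - 1)) * d = 0"
    by (auto simp: U1_def c_def d_def)
  \<comment> \<open>This lets \<open>x * ?Q\<close>, which has no constant term, be indexed by
    \<open>l\<close> up to \<open>Suc r\<close> like \<open>?P\<close>.\<close>
  have B0: "?B (Suc r) = 0"
    using len by (simp add: elem_sym_eq_0)
  have P: "?P = (\<Sum>l\<le>Suc r. ?A l * x ^ (Suc r - l))"
    using len by (simp add: prod_list_add_conv_elem_sym)
  have Q: "?Q = (\<Sum>l\<le>r. ?B l * x ^ (r - l))"
    using len by (simp add: prod_list_add_conv_elem_sym)
  have xQ: "x * ?Q = (\<Sum>l\<le>r. ?B l * x ^ (Suc r - l))"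
    by (simp add: Q sum_distrib_left Suc_diff_le mult_ac)
  have D: "?P - x * ?Q = (\<Sum>l\<le>r. (?A l - ?B l) * x ^ (Suc r - l)) + ?A (Suc r)"
    by (simp only: P xQ) (simp add: sum_subtractf left_diff_distrib)
  have "?P - x * ?Q = (\<Sum>l\<le>Suc r. (?A l - ?B l) * x ^ (Suc r - l))"
    by (simp add: D B0)
  also have "\<dots> = (\<Sum>l\<le>r. (?A (Suc l) - ?B (Suc l)) * x ^ (r - l))"
    by (subst sum.atMost_Suc_shift) simp
  finally have "x * (?P - x * ?Q) = (\<Sum>l\<le>r. (?A (Suc l) - ?B (Suc l)) * x ^ (Suc r - l))"
    by (simp add: sum_distrib_left Suc_diff_le mult_ac)
  then have E: "x * (?P - x * ?Q + ?Q) =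
      (\<Sum>l\<le>r. (?A (Suc l) - ?B (Suc l) + ?B l) * x ^ (Suc r - l))"
    by (simp add: distrib_left xQ ring_distribs sum.distrib)
  \<comment> \<open>Regrouped so that both summands are known coefficientwise in the powers
    \<open>x ^ (Suc r - l)\<close>.\<close>
  have "?P * (d * x + c) - x * ?Q * (d * x + c - d) =
      c * (?P - x * ?Q) + d * (x * (?P - x * ?Q + ?Q))"
    by (simp add: algebra_simps)
  also have "\<dots> = c * ?A (Suc r) + (\<Sum>l\<le>r. ((?A l - ?B l) * c +
      (?A (Suc l) - ?B (Suc l) + ?B l) * d) * x ^ (Suc r - l))"
    \<comment> \<open>\<open>E\<close> has to come first, because its left side contains that of
      \<open>D\<close>.\<close>
    unfolding E unfolding D
    by (simp add: sum_distrib_left algebra_simps flip: sum.distrib)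
  also have "(\<Sum>l\<le>r. ((?A l - ?B l) * c +
      (?A (Suc l) - ?B (Suc l) + ?B l) * d) * x ^ (Suc r - l)) = 0"
  proof (intro sum.neutral ballI)
    fix l assume "l \<in> {..r}"
    then consider "l < r" | "l = r"
      by fastforce
    \<comment> \<open>For \<open>l < r\<close> this is the equation of \<open>U1\<close> with index
      \<open>l + 1\<close>. For \<open>l = r\<close> it reads \<open>- d * c + c * d = 0\<close>, by
      the choice of \<open>c\<close> and \<open>d\<close>.\<close>
    then have "(?A l - ?B l) * c + (?A (Suc l) - ?B (Suc l) + ?B l) * d = 0"
    proof cases
      case 1
      then show ?thesis
        using eq[of "Suc l"] by simp
    next
      case 2
      then show ?thesis
        by (simp add: B0 c_def d_def algebra_simps)
    qed
    then show "((?A l - ?B l) * c +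
        (?A (Suc l) - ?B (Suc l) + ?B l) * d) * x ^ (Suc r - l) = 0"
      by simp
  qed
  finally show ?thesis
    by simp
qed

section \<open>Products of Pochhammer symbols\<close>

lemma foldl_mult_conv_prod_list:
  fixes z :: "'a::comm_monoid_mult"
  shows "foldl (\<lambda>y a. y * f a) z xs = z * prod_list (map f xs)"
  by (induction xs arbitrary: z) (simp_all add: mult_ac)

lemma prod_list_map_mult:
  fixes f g :: "'b \<Rightarrow> 'a::comm_monoid_mult"
  shows "(\<Prod>x\<leftarrow>xs. f x * g x) = prod_list (map f xs) * prod_list (map g xs)"
  by (induction xs) (simp_all add: mult_ac)

lemma prod_list_pochhammer_Suc:
  fixes xs :: "'a::comm_ring_1 list"
  shows "(\<Prod>a\<leftarrow>xs. pochhammer a (Suc n)) = prod_list xs * (\<Prod>a\<leftarrow>xs. pochhammer (a + 1) n)"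
  by (simp add: pochhammer_rec prod_list_map_mult)

lemma prod_list_pochhammer_plus1_Suc:
  fixes xs :: "'a::comm_ring_1 list"
  shows "(\<Prod>a\<leftarrow>xs. pochhammer (a + 1) (Suc n)) =
    (\<Prod>a\<leftarrow>xs. pochhammer (a + 1) n) * (\<Prod>a\<leftarrow>xs. of_nat (Suc n) + a)"
  by (simp add: pochhammer_Suc prod_list_map_mult[symmetric] add_ac)

text \<open>Euler's limit for \<open>rGamma (x + 1)\<close> has one more Pochhammer factor,
  \<open>x + 1 + n\<close>, and one more \<open>n\<close> in the denominator; their quotient tends
  to 1.\<close>

lemma pochhammer_plus1_asymptotics:
  fixes x :: complex
  shows "(\<lambda>n. pochhammer (x + 1) n / (fact n * exp (x * of_real (ln (real n)))))
    \<longlonglongrightarrow> rGamma (x + 1)"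
proof -
  have "(\<lambda>n. (x + 1) / of_nat n) \<longlonglongrightarrow> 0"
    by (rule lim_const_over_n)
  then have lim1: "(\<lambda>n. (x + 1) / of_nat n + 1) \<longlonglongrightarrow> 1"
    by (auto intro: tendsto_eq_intros)
  then have "(\<lambda>n. rGamma_series (x + 1) n / ((x + 1) / of_nat n + 1)) \<longlonglongrightarrow> rGamma (x + 1) / 1"
    by (intro tendsto_divide rGamma_series_LIMSEQ) auto
  moreover have "\<forall>\<^sub>F n in sequentially. (x + 1) / of_nat n + 1 \<noteq> 0"
    using lim1 by (rule tendsto_imp_eventually_ne) simp
  then have "\<forall>\<^sub>F n in sequentially. rGamma_series (x + 1) n / ((x + 1) / of_nat n + 1) =
      pochhammer (x + 1) n / (fact n * exp (x * of_real (ln (real n))))"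
    using eventually_gt_at_top[of 0]
  proof eventually_elim
    case (elim n)
    have "exp ((x + 1) * of_real (ln (real n))) = exp (x * of_real (ln (real n))) * of_nat n"
      using elim by (simp add: distrib_right exp_add exp_of_real)
    moreover have "x + 1 + of_nat n = ((x + 1) / of_nat n + 1) * of_nat n"
      using elim by (simp add: field_simps)
    ultimately show ?case
      using elim by (simp add: rGamma_series_def pochhammer_Suc)
  qed
  ultimately show ?thesis
    by (simp add: tendsto_cong)
qed

lemma prod_list_pochhammer_plus1_asymptotics:
  fixes xs :: "complex list"
  shows "(\<lambda>n. (\<Prod>x\<leftarrow>xs. pochhammer (x + 1) n) /
      (fact n ^ length xs * exp (sum_list xs * of_real (ln (real n)))))
    \<longlonglongrightarrow> (\<Prod>x\<leftarrow>xs. rGamma (x + 1))"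
proof (induction xs)
  case (Cons x xs)
  from tendsto_mult[OF pochhammer_plus1_asymptotics[of x] this] show ?case
    by (simp add: distrib_right exp_add mult_ac)
qed simp

text \<open>This also holds at the poles of \<open>Gamma\<close>, where both \<open>rGamma\<close>
  and \<open>inverse (Gamma _)\<close> are 0. Hence limits taken with \<open>rGamma\<close> respect
  the convention for gamma quotients.\<close>

lemma prod_list_rGamma: "(\<Prod>x\<leftarrow>xs. rGamma (f x)) = inverse (prod_list (map Gamma (map f xs)))"
  by (induction xs) (simp_all add: rGamma_inverse_Gamma)

lemma prod_list_pochhammer_quotient_LIMSEQ:
  fixes \<alpha> \<beta> :: "complex list"
  assumes len: "length \<alpha> = length \<beta> + 1"
    and sum: "sum_list \<beta> - sum_list \<alpha> = 1"
    and \<beta>: "\<forall>b\<in>set \<beta>. b + 1 \<notin> \<int>\<^sub>\<le>\<^sub>0"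
  shows "(\<lambda>n. of_nat n *
      ((\<Prod>a\<leftarrow>\<alpha>. pochhammer (a + 1) n) / ((\<Prod>b\<leftarrow>\<beta>. pochhammer (b + 1) n) * fact n)))
    \<longlonglongrightarrow> Gamma_quotient (map (\<lambda>b. b + 1) \<beta>) (map (\<lambda>a. a + 1) \<alpha>)"
proof -
  let ?e = "\<lambda>xs n. fact n ^ length xs * exp (sum_list xs * of_real (ln (real n))) :: complex"
  let ?p = "\<lambda>xs n. \<Prod>x\<leftarrow>xs. pochhammer (x + 1 :: complex) n"
  have "(\<Prod>b\<leftarrow>\<beta>. rGamma (b + 1)) \<noteq> 0"
    using \<beta> by (auto simp: prod_list_zero_iff rGamma_eq_zero_iff)
  then have "(\<lambda>n. (?p \<alpha> n / ?e \<alpha> n) / (?p \<beta> n / ?e \<beta> n))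
      \<longlonglongrightarrow> (\<Prod>a\<leftarrow>\<alpha>. rGamma (a + 1)) / (\<Prod>b\<leftarrow>\<beta>. rGamma (b + 1))"
    by (intro tendsto_divide prod_list_pochhammer_plus1_asymptotics)
  also have "(\<Prod>a\<leftarrow>\<alpha>. rGamma (a + 1)) / (\<Prod>b\<leftarrow>\<beta>. rGamma (b + 1)) =
      Gamma_quotient (map (\<lambda>b. b + 1) \<beta>) (map (\<lambda>a. a + 1) \<alpha>)"
    by (simp only: Gamma_quotient_def prod_list_rGamma) (simp add: field_simps)
  finally have lim: "(\<lambda>n. (?p \<alpha> n / ?e \<alpha> n) / (?p \<beta> n / ?e \<beta> n))
      \<longlonglongrightarrow> Gamma_quotient (map (\<lambda>b. b + 1) \<beta>) (map (\<lambda>a. a + 1) \<alpha>)" .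
  have "\<forall>\<^sub>F n in sequentially. (?p \<alpha> n / ?e \<alpha> n) / (?p \<beta> n / ?e \<beta> n) =
      of_nat n * (?p \<alpha> n / (?p \<beta> n * fact n))"
    using eventually_gt_at_top[of 0]
  proof eventually_elim
    case (elim n)
    have "sum_list \<beta> = sum_list \<alpha> + 1"
      using sum by (simp add: algebra_simps)
    \<comment> \<open>The lengths differ by one, which costs a factorial; the sums differ by one,
      which gives \<open>exp (ln n) = n\<close>.\<close>
    then have "fact n * ?e \<beta> n = of_nat n * ?e \<alpha> n"
      using elim len by (simp add: distrib_right exp_add exp_of_real)
    then have "?e \<beta> n / ?e \<alpha> n = of_nat n / fact n"
      by (simp add: field_simps)
    moreover have "(?p \<alpha> n / ?e \<alpha> n) / (?p \<beta> n / ?e \<beta> n) = ?p \<alpha> n / ?p \<beta> n * (?e \<beta> n / ?e \<alpha> n)"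
      by simp
    ultimately show ?case
      by simp
  qed
  with lim show ?thesis
    by (simp only: tendsto_cong)
qed

section \<open>The summation formula\<close>

text \<open>Induction on \<open>n\<close>: over a common denominator, the step is
  \<open>U1_polynomial_identity\<close> at \<open>x = n + 1\<close>.\<close>

lemma hypergeo_partial_sum:
  fixes \<alpha> \<beta> :: "complex list"
  assumes U: "(\<alpha>, \<beta>) \<in> U1 r"
    and \<beta>: "\<forall>b\<in>set \<beta>. b + 1 \<notin> \<int>\<^sub>\<le>\<^sub>0"
  defines "c \<equiv> elem_sym (r + 1) \<alpha> + elem_sym r \<beta>"
    and "d \<equiv> - elem_sym r \<alpha> + elem_sym r \<beta>"
  shows "c * (\<Sum>k\<le>n. fps_nth (fps_hypergeo \<alpha> (map (\<lambda>b. b + 1) \<beta>) 1) k) =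
    (d * of_nat n + c) *
      ((\<Prod>a\<leftarrow>\<alpha>. pochhammer (a + 1) n) / ((\<Prod>b\<leftarrow>\<beta>. pochhammer (b + 1) n) * fact n))"
proof (induction n)
  case 0
  show ?case
    by (simp add: map_replicate_const del: fps_hypergeo_nth)
next
  case (Suc n)
  let ?m = "of_nat (Suc n) :: complex"
  let ?p = "\<Prod>a\<leftarrow>\<alpha>. pochhammer (a + 1) n"
  let ?q = "\<lambda>n. \<Prod>b\<leftarrow>\<beta>. pochhammer (b + 1) n"
  let ?P = "\<Prod>a\<leftarrow>\<alpha>. ?m + a" and ?Q = "\<Prod>b\<leftarrow>\<beta>. ?m + b"
  let ?t = "\<lambda>k. fps_nth (fps_hypergeo \<alpha> (map (\<lambda>b. b + 1) \<beta>) 1) k"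
  have len: "length \<alpha> = r + 1"
    using U by (simp add: U1_def)
  \<comment> \<open>Splitting off the first factor of each numerator symbol leaves the product of
    \<open>\<alpha>\<close>, which is the top elementary symmetric function.\<close>
  have t: "?t (Suc n) = elem_sym (r + 1) \<alpha> * ?p / (?q (Suc n) * fact (Suc n))"
    using elem_sym_length[of \<alpha>] len
    by (simp add: foldl_mult_conv_prod_list o_def prod_list_pochhammer_Suc
        del: fact_Suc)
  have q: "?q (Suc n) = ?q n * ?Q"
    by (rule prod_list_pochhammer_plus1_Suc)
  have "?q (Suc n) \<noteq> 0"
    using \<beta> by (auto simp: prod_list_zero_iff)
      (metis pochhammer_eq_0_imp_nonpos_Int)
  with q have nz: "?q n \<noteq> 0" "?Q \<noteq> 0"
    by simp_all
  have id: "?P * (d * ?m + c) = ?m * ?Q * (d * ?m + c - d) + c * elem_sym (r + 1) \<alpha>"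
    using U1_polynomial_identity[OF U, of ?m] unfolding c_def d_def
    by (simp only: diff_eq_eq add_ac)
  have "c * (\<Sum>k\<le>Suc n. ?t k) = (d * of_nat n + c) * (?p / (?q n * fact n)) + c * ?t (Suc n)"
    by (simp only: sum.atMost_Suc distrib_left Suc.IH)
  also have "(d * of_nat n + c) * (?p / (?q n * fact n)) =
      (d * ?m + c - d) * ?m * ?Q * ?p / (?q (Suc n) * fact (Suc n))"
  proof -
    \<comment> \<open>The old factor, rewritten in terms of \<open>n + 1\<close> to match
      \<open>id\<close>.\<close>
    have "d * of_nat n + c = d * ?m + c - d"
      by (simp add: algebra_simps)
    moreover have "fact (Suc n) = ?m * fact n"
      by simp
    moreover have "?m \<noteq> 0"
      by (rule of_nat_neq_0)
    ultimately show ?thesis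
      using nz unfolding q by simp
  qed
  also have "\<dots> + c * ?t (Suc n) =
      (?m * ?Q * (d * ?m + c - d) + c * elem_sym (r + 1) \<alpha>) * ?p / (?q (Suc n) * fact (Suc n))"
    unfolding t by (simp only: add_divide_distrib distrib_left times_divide_eq_right mult_ac)
  also have "\<dots> = (d * ?m + c) * (?p * ?P / (?q (Suc n) * fact (Suc n)))"
    unfolding id[symmetric] by (simp only: times_divide_eq_right mult_ac)
  finally show ?case
    by (simp only: prod_list_pochhammer_plus1_Suc[of n \<alpha>])
qed

theorem theorem2p4:
  fixes r :: nat and \<alpha> \<beta> :: "complex list"
  assumes "r \<ge> 1"
    and "(\<alpha>, \<beta>) \<in> U1 r"
    and "\<forall>b\<in>set \<beta>. b + 1 \<notin> \<int>\<^sub>\<le>\<^sub>0"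
    and "elem_sym (r + 1) \<alpha> + elem_sym r \<beta> \<noteq> 0"
    and "elem_sym r \<alpha> \<noteq> elem_sym r \<beta> \<or> (\<exists>a\<in>set \<alpha>. a + 1 \<in> \<int>\<^sub>\<le>\<^sub>0)"
  shows "hypergeo_1_converges \<alpha> (map (\<lambda>b. b + 1) \<beta>) \<and>
    hypergeo_1 \<alpha> (map (\<lambda>b. b + 1) \<beta>) =
      (- elem_sym r \<alpha> + elem_sym r \<beta>) / (elem_sym (r + 1) \<alpha> + elem_sym r \<beta>) *
      Gamma_quotient (map (\<lambda>b. b + 1) \<beta>) (map (\<lambda>a. a + 1) \<alpha>)"
proof -
  define c where "c = elem_sym (r + 1) \<alpha> + elem_sym r \<beta>"
  define d where "d = - elem_sym r \<alpha> + elem_sym r \<beta>"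
  define u where "u n = (\<Prod>a\<leftarrow>\<alpha>. pochhammer (a + 1) n) /
    ((\<Prod>b\<leftarrow>\<beta>. pochhammer (b + 1) n) * fact n)" for n
  let ?t = "fps_nth (fps_hypergeo \<alpha> (map (\<lambda>b. b + 1) \<beta>) 1)"
  let ?G = "Gamma_quotient (map (\<lambda>b. b + 1) \<beta>) (map (\<lambda>a. a + 1) \<alpha>)"
  have c: "c \<noteq> 0"
    using assms(4) by (simp add: c_def)
  have partial: "c * (\<Sum>k\<le>n. ?t k) = (d * of_nat n + c) * u n" for n
    unfolding c_def d_def u_def by (rule hypergeo_partial_sum) fact+
  have "(\<lambda>n. (d * of_nat n + c) * u n) \<longlonglongrightarrow> d * ?G"
  proof (cases "d = 0")
    case True
    with assms(5) obtain a where a: "a \<in> set \<alpha>" "a + 1 \<in> \<int>\<^sub>\<le>\<^sub>0"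
      by (auto simp: d_def)
    then obtain N where N: "a + 1 = - of_nat N"
      by (auto elim: nonpos_Ints_cases')
    \<comment> \<open>For \<open>n > N\<close> the symbol of \<open>a + 1 = - N\<close> contains the
      factor 0.\<close>
    have "\<forall>\<^sub>F n in sequentially. (d * of_nat n + c) * u n = 0"
      using eventually_gt_at_top[of N]
    proof eventually_elim
      case (elim n)
      then have "pochhammer (a + 1) n = 0"
        by (simp add: N pochhammer_of_nat_eq_0_iff)
      with a(1) have "(\<Prod>a\<leftarrow>\<alpha>. pochhammer (a + 1) n) = 0"
        by (force simp: prod_list_zero_iff)
      then show ?case
        by (simp add: u_def)
    qed
    with True show ?thesis
      by (simp add: tendsto_eventually)
  next
    case False
    \<comment> \<open>In the equation with \<open>l = 1\<close> the multiple of \<open>c\<close>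
      drops out, since both elementary symmetric functions of index 0 are 1.\<close>
    from assms(1,2) have "(elem_sym 1 \<alpha> - elem_sym 1 \<beta> + 1) * d = 0"
      by (auto simp: U1_def d_def dest!: bspec[of _ _ 1])
    with False have "elem_sym 1 \<alpha> - elem_sym 1 \<beta> + 1 = 0"
      by (simp only: mult_eq_0_iff simp_thms)
    then have sum: "sum_list \<beta> - sum_list \<alpha> = 1"
      unfolding elem_sym_1 by algebra
    have len: "length \<alpha> = length \<beta> + 1"
      using assms(2) by (simp add: U1_def)
    have nu: "(\<lambda>n. of_nat n * u n) \<longlonglongrightarrow> ?G"
      unfolding u_def using len sum assms(3) by (rule prod_list_pochhammer_quotient_LIMSEQ)
    \<comment> \<open>Convergence of \<open>n * u n\<close> forces \<open>u n\<close> to 0, so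
      \<open>c * u n\<close> does not contribute to the limit.\<close>
    then have "(\<lambda>n. of_nat n * u n * inverse (of_nat n)) \<longlonglongrightarrow> ?G * 0"
      by (intro tendsto_mult lim_inverse_n)
    moreover have "\<forall>\<^sub>F n in sequentially. of_nat n * u n * inverse (of_nat n) = u n"
      using eventually_gt_at_top[of 0] by eventually_elim simp
    ultimately have "u \<longlonglongrightarrow> 0"
      by (simp add: tendsto_cong)
    with nu have "(\<lambda>n. d * (of_nat n * u n) + c * u n) \<longlonglongrightarrow> d * ?G + c * 0"
      by (intro tendsto_intros)
    then show ?thesis
      by (simp add: algebra_simps)
  qed
  then have "(\<lambda>n. c * (\<Sum>k\<le>n. ?t k) / c) \<longlonglongrightarrow> d * ?G / c"
    unfolding partial by (intro tendsto_divide tendsto_const c)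
  then have "?t sums (d / c * ?G)"
    using c by (simp add: sums_def_le)
  then show ?thesis
    by (simp add: hypergeo_1_converges_def hypergeo_1_def eval_fps_def sums_iff c_def d_def
        del: fps_hypergeo_nth)
qed

end
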